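(* Assume $Y = \{y \in \mathbb{R}^m : Ay = b,\ y\ge 0\}$ with $A$ of full row rank, and that the linear program $z^* := \min\{c^\top x + d^\top y : Tx + Qy = h,\ x\in X,\ y\in Y\}$ has a finite optimal value. Let $\hat\alpha$ be an optimal solution of $$\max_{\alpha\in\mathbb{R}^p}\Big\{-\alpha^\top h + \sigma_X(c + T^\top\alpha) + \sigma_Y(Q^\top\alpha + d)\Big\},$$ let $B$ be an optimal basis for $\min\{(Q^\top\hat\alpha + d)^\top y : y \in Y\}$, and let $C_B$ be the associated corner. Then $$\inf\{c^\top x + \theta : x \in X,\ (h - Tx,\theta) \in \mathrm{epi}(f_{C_B})\} = z^*,$$ i.e., the facets of $\mathrm{epi}(f_{C_B})$ (corner Benders' cuts) together with $x\in X$ recover the bound $z^*$; moreover the Lagrangian cut $\hat\alpha^\top(h - Tx) + \theta \ge \sigma_{\mathrm{epi}(f_Y)}(\hat\alpha,1)$ is valid for $\{(x,\theta) : (h-Tx,\theta)\in\mathrm{epi}(f_{C_B})\}$.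
   Context: $X\subseteq\mathbb{R}^n$ is a nonempty polyhedron; $T\in\mathbb{R}^{p\times n}$, $Q\in\mathbb{R}^{p\times m}$, $h\in\mathbb{R}^p$, $c\in\mathbb{R}^n$, $d\in\mathbb{R}^m$. For $\mathcal{X}\subseteq\mathbb{R}^k$, $\sigma_{\mathcal{X}}(\alpha) := \inf_{x\in\mathcal{X}}\alpha^\top x$ ($\sigma_{\mathcal{X}}(\alpha,\alpha_0)$ at a concatenated vector). For $\mathcal{Y}\subseteq\mathbb{R}^m$, $f_{\mathcal{Y}}(w) := \inf_{y\in\mathcal{Y}}\{d^\top y : Qy = w\}$, $\mathrm{epi}(f_{\mathcal{Y}}) := \{(w,\theta) : \theta \ge f_{\mathcal{Y}}(w)\}$. A basis is a set $B\subseteq[m]$ with $A_B$ square invertible, $N := [m]\setminus B$; $B$ is optimal for $\min\{g^\top y : y\in Y\}$ if $A_B^{-1}b\ge 0$ and $g_N^\top - g_B^\top A_B^{-1}A_N \ge 0$. The corner associated with $B$ is $C_B := \{y\in\mathbb{R}^m : Ay = b,\ y_N \ge 0\}$. *)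

theory Defs
  imports "HOL-Analysis.Analysis"
begin

text \<open>Support function (infimum of a linear functional over a set), extended-real valued.\<close>
definition sigma :: "'a::real_inner set \<Rightarrow> 'a \<Rightarrow> ereal" where
  "sigma S \<alpha> = (INF s\<in>S. ereal (\<alpha> \<bullet> s))"

text \<open>Value function f_Y(w) = inf { d'y : y in Y, Q y = w }.\<close>
definition fval :: "real^'m \<Rightarrow> real^'m^'p \<Rightarrow> (real^'m) set \<Rightarrow> real^'p \<Rightarrow> ereal" where
  "fval d Q Y w = (INF y\<in>{y\<in>Y. Q *v y = w}. ereal (d \<bullet> y))"

definition epi :: "(real^'p \<Rightarrow> ereal) \<Rightarrow> ((real^'p) \<times> real) set" where
  "epi f = {(w, \<theta>). ereal \<theta> \<ge> f w}"

text \<open>B is a basis of A: A_B (columns of A indexed by B) is square and invertible,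
  i.e. |B| = number of rows and A_B has trivial kernel.\<close>
definition is_basis :: "real^'m^'k \<Rightarrow> 'm set \<Rightarrow> bool" where
  "is_basis A B \<longleftrightarrow> card B = CARD('k) \<and>
     (\<forall>y. (\<forall>j. j \<notin> B \<longrightarrow> y $ j = 0) \<and> A *v y = 0 \<longrightarrow> y = 0)"

text \<open>The vector with B-part A_B^{-1} b and zero N-part.\<close>
definition basic_sol :: "real^'m^'k \<Rightarrow> real^'k \<Rightarrow> 'm set \<Rightarrow> real^'m" where
  "basic_sol A b B = (THE y. (\<forall>j. j \<notin> B \<longrightarrow> y $ j = 0) \<and> A *v y = b)"

text \<open>The multiplier vector pi with pi' = g_B' A_B^{-1}, i.e. pi' A_B = g_B'.\<close>
definition basis_mult :: "real^'m^'k \<Rightarrow> real^'m \<Rightarrow> 'm set \<Rightarrow> real^'k" where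
  "basis_mult A g B = (THE \<pi>. \<forall>j\<in>B. (transpose A *v \<pi>) $ j = g $ j)"

text \<open>B is optimal for min { g'y : A y = b, y \<ge> 0 }:
  A_B^{-1} b \<ge> 0 and g_N' - g_B' A_B^{-1} A_N \<ge> 0.\<close>
definition optimal_basis :: "real^'m^'k \<Rightarrow> real^'k \<Rightarrow> real^'m \<Rightarrow> 'm set \<Rightarrow> bool" where
  "optimal_basis A b g B \<longleftrightarrow> is_basis A B \<and>
     (\<forall>j\<in>B. basic_sol A b B $ j \<ge> 0) \<and>
     (\<forall>j. j \<notin> B \<longrightarrow> g $ j - (transpose A *v basis_mult A g B) $ j \<ge> 0)"

definition corner :: "real^'m^'k \<Rightarrow> real^'k \<Rightarrow> 'm set \<Rightarrow> (real^'m) set" where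
  "corner A b B = {y. A *v y = b \<and> (\<forall>j. j \<notin> B \<longrightarrow> y $ j \<ge> 0)}"

end

theory Submission
  imports Defs
begin

(*
  Write g = Q'\<alpha>hat + d. Optimality of B for g gives a multiplier \<pi> with \<pi>'A_B = g_B' whose
  reduced costs g - A'\<pi> vanish on B and are nonnegative off B. Hence
  g'y = \<pi>'b + (g - A'\<pi>)'y \<ge> \<pi>'b = g'y_B on the whole corner C_B, and the basic solution y_B
  lies in Y, so \<sigma>_{C_B}(g) = \<sigma>_Y(g). The Lagrangian dual value at \<alpha>hat, which is at least z*
  by LP duality, therefore stays a lower bound when Y is relaxed to C_B, and the problem over
  epi(f_{C_B}) is exactly that relaxation. The cut is valid because
  \<sigma>_{epi(f_Y)}(\<alpha>hat, 1) \<le> \<sigma>_Y(g) = \<sigma>_{C_B}(g) \<le> \<alpha>hat'w + \<theta> for (w, \<theta>) in epi(f_{C_B}).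
*)

section \<open>Polyhedra and Farkas' lemma\<close>

lemma polyhedron_iff_constraints:
  fixes P :: "'a::euclidean_space set"
  shows "polyhedron P \<longleftrightarrow> (\<exists>H. finite H \<and> P = {v. \<forall>(a, \<beta>)\<in>H. a \<bullet> v \<le> \<beta>})"
proof
  assume "polyhedron P"
  then obtain F where F: "finite F" "P = \<Inter>F" "\<forall>S\<in>F. \<exists>a \<beta>. a \<noteq> 0 \<and> S = {x. a \<bullet> x \<le> \<beta>}"
    unfolding polyhedron_def by blast
  then obtain a \<beta> where "\<forall>S\<in>F. S = {x. a S \<bullet> x \<le> \<beta> S}"
    by metis
  then have "P = {v. \<forall>(a, \<beta>)\<in>(\<lambda>S. (a S, \<beta> S)) ` F. a \<bullet> v \<le> \<beta>}"
    using F(2) by auto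
  then show "\<exists>H. finite H \<and> P = {v. \<forall>(a, \<beta>)\<in>H. a \<bullet> v \<le> \<beta>}"
    using F(1) by blast
next
  assume "\<exists>H. finite H \<and> P = {v. \<forall>(a, \<beta>)\<in>H. a \<bullet> v \<le> \<beta>}"
  then obtain H where H: "finite H" "P = {v. \<forall>(a, \<beta>)\<in>H. a \<bullet> v \<le> \<beta>}" by blast
  then have "P = \<Inter> ((\<lambda>(a, \<beta>). {v. a \<bullet> v \<le> \<beta>}) ` H)" by auto
  then show "polyhedron P"
    using H(1) by (auto intro!: polyhedron_Inter simp: polyhedron_halfspace_le)
qed

lemma polyhedron_vimage_linear:
  fixes f :: "'a::euclidean_space \<Rightarrow> 'b::euclidean_space"
  assumes "linear f" and "polyhedron S"
  shows "polyhedron (f -` S)"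
proof -
  obtain H where H: "finite H" "S = {x. \<forall>(a, \<beta>)\<in>H. a \<bullet> x \<le> \<beta>}"
    using assms(2) polyhedron_iff_constraints by blast
  have "adjoint f a \<bullet> v = a \<bullet> f v" for a v
    using adjoint_works[OF assms(1)] by (metis inner_commute)
  then have "f -` S = {v. \<forall>(a, \<beta>)\<in>(\<lambda>(a, \<beta>). (adjoint f a, \<beta>)) ` H. a \<bullet> v \<le> \<beta>}"
    using H(2) by auto
  moreover have "finite ((\<lambda>(a, \<beta>). (adjoint f a, \<beta>)) ` H)"
    using H(1) by simp
  ultimately show ?thesis
    unfolding polyhedron_iff_constraints by blast
qed

lemma polyhedron_Times:
  fixes X :: "'a::euclidean_space set" and Y :: "'b::euclidean_space set"
  assumes "polyhedron X" and "polyhedron Y"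
  shows "polyhedron (X \<times> Y)"
proof -
  have "X \<times> Y = fst -` X \<inter> snd -` Y" by auto
  then show ?thesis
    using assms by (simp add: polyhedron_vimage_linear linear_fst linear_snd)
qed

lemma polyhedron_standard_form: "polyhedron {y::real^'m. A *v y = b \<and> (\<forall>j. 0 \<le> y $ j)}"
proof -
  have "{y::real^'m. A *v y = b \<and> (\<forall>j. 0 \<le> y $ j)}
      = (*v) A -` {b} \<inter> \<Inter> (range (\<lambda>j. {y. axis j 1 \<bullet> y \<ge> 0}))"
    by (auto simp: inner_axis')
  moreover have "polyhedron ((*v) A -` {b})"
    by (simp add: polyhedron_vimage_linear affine_imp_polyhedron)
  moreover have "polyhedron (\<Inter> (range (\<lambda>j. {y::real^'m. axis j 1 \<bullet> y \<ge> 0})))"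
    by (intro polyhedron_Inter) (auto simp: polyhedron_halfspace_ge)
  ultimately show ?thesis by simp
qed

lemma farkas_infeasibility_certificate:
  fixes S :: "('a::euclidean_space \<times> real) set"
  assumes "finite S" and infeasible: "\<And>v. \<exists>(g, \<gamma>)\<in>S. \<gamma> < g \<bullet> v"
  shows "(0, -1) \<in> convex_cone hull S"
proof (rule ccontr)
  let ?K = "convex_cone hull S"
  assume "(0, -1) \<notin> ?K"
  then obtain a t0 where sep: "a \<bullet> (0, -1) < t0" "\<forall>k\<in>?K. t0 < a \<bullet> k"
    using separating_hyperplane_closed_point[OF convex_convex_cone_hull closed_convex_cone_hull[OF assms(1)]]
    by blast
  have "t0 < 0" using sep(2) convex_cone_hull_contains_0 by fastforce
  have nonneg: "0 \<le> a \<bullet> k" if "k \<in> ?K" for k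
  proof (rule ccontr)
    assume neg: "\<not> 0 \<le> a \<bullet> k"
    have "0 \<le> t0 / (a \<bullet> k)" using neg \<open>t0 < 0\<close> by (simp add: divide_nonpos_neg)
    then have "(t0 / (a \<bullet> k)) *\<^sub>R k \<in> ?K"
      using conic_convex_cone_hull[of S] that unfolding conic_def by blast
    then show False using sep(2) neg by fastforce
  qed
  obtain w t where a: "a = (w, t)" by (cases a)
  have "0 < t" using sep(1) \<open>t0 < 0\<close> a by simp
  (* the point -(1/t) w would satisfy every constraint *)
  obtain g \<gamma> where g: "(g, \<gamma>) \<in> S" "\<gamma> < g \<bullet> (- (1 / t) *\<^sub>R w)"
    using infeasible by blast
  have "0 \<le> w \<bullet> g + t * \<gamma>"
    using nonneg[of "(g, \<gamma>)"] g(1) a hull_subset by fastforce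
  then show False using g(2) \<open>0 < t\<close> by (simp add: field_simps inner_commute)
qed

section \<open>Lagrangian duality\<close>

lemma valid_inequality_convex_cone_hull:
  fixes S :: "(('a::euclidean_space \<times> real) \<times> ('b::euclidean_space \<times> real)) set"
  assumes valid: "\<And>g \<gamma> \<mu> l. ((g, \<gamma>), (\<mu>, l)) \<in> S \<Longrightarrow>
      0 \<le> l \<and> (\<forall>v\<in>P. g \<bullet> v - \<gamma> \<le> \<mu> \<bullet> (f v - h) + l * (c \<bullet> v - r))"
    and "((g, \<gamma>), (\<mu>, l)) \<in> convex_cone hull S"
  shows "0 \<le> l \<and> (\<forall>v\<in>P. g \<bullet> v - \<gamma> \<le> \<mu> \<bullet> (f v - h) + l * (c \<bullet> v - r))"
proof -
  (* validity is a family of homogeneous linear inequalities in the tagged coefficient vector *)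
  define C :: "(('a \<times> real) \<times> ('b \<times> real)) set" where
    "C = (\<Inter>w \<in> insert ((0, 0), (0, 1)) ((\<lambda>v. ((- v, 1), (f v - h, c \<bullet> v - r))) ` P).
            {q. 0 \<le> w \<bullet> q})"
  have C: "((g, \<gamma>), (\<mu>, l)) \<in> C \<longleftrightarrow>
      0 \<le> l \<and> (\<forall>v\<in>P. g \<bullet> v - \<gamma> \<le> \<mu> \<bullet> (f v - h) + l * (c \<bullet> v - r))" for g \<gamma> \<mu> l
    by (auto simp: C_def inner_commute[of _ \<mu>] inner_commute[of _ g] mult.commute[of _ l])
  have "convex_cone C"
    unfolding C_def by (rule convex_cone_Inter) (auto simp only: convex_cone_halfspace_ge)
  moreover have "S \<subseteq> C"
    using valid C by fast
  ultimately have "convex_cone hull S \<subseteq> C" by (simp add: hull_minimal)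
  then show ?thesis using assms(2) C by blast
qed

lemma lagrange_multiplier_approx:
  fixes f :: "'a::euclidean_space \<Rightarrow> 'b::euclidean_space"
  assumes "polyhedron P" and f: "linear f"
    and feasible: "v0 \<in> P" "f v0 = h"
    and lower: "\<And>v. v \<in> P \<Longrightarrow> f v = h \<Longrightarrow> z \<le> c \<bullet> v"
    and "0 < \<epsilon>"
  obtains \<alpha> where "\<And>v. v \<in> P \<Longrightarrow> z - \<epsilon> \<le> c \<bullet> v + \<alpha> \<bullet> (f v - h)"
proof -
  obtain H where H: "finite H" "P = {v. \<forall>(a, \<beta>)\<in>H. a \<bullet> v \<le> \<beta>}"
    using assms(1) polyhedron_iff_constraints by blast
  have adj: "adjoint f e \<bullet> v = f v \<bullet> e" for e v
    using adjoint_works[OF f] by (metis inner_commute)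
  (* Each constraint is tagged with its contribution to the multiplier of f v = h and to the
     weight of the objective cut, so that the conic combination provided by Farkas' lemma for
     the constraints can be read off in the tags. *)
  define S :: "(('a \<times> real) \<times> ('b \<times> real)) set" where
    "S = (\<lambda>(a, \<beta>). ((a, \<beta>), (0, 0))) ` H
       \<union> (\<lambda>e. ((adjoint f e, e \<bullet> h), (e, 0))) ` Basis
       \<union> (\<lambda>e. ((- adjoint f e, - (e \<bullet> h)), (- e, 0))) ` Basis
       \<union> {((c, z - \<epsilon>), (0, 1))}"
  have "(0, -1) \<in> convex_cone hull (fst ` S)"
  proof (rule farkas_infeasibility_certificate)
    show "finite (fst ` S)" using H(1) by (simp add: S_def)
  next
    fix v
    show "\<exists>(g, \<gamma>)\<in>fst ` S. \<gamma> < g \<bullet> v"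
    proof (rule ccontr)
      assume "\<not> ?thesis"
      then have sat: "g \<bullet> v \<le> \<gamma>" if "((g, \<gamma>), t) \<in> S" for g \<gamma> t
        using that by (force intro: image_eqI[where x = "((g, \<gamma>), t)"])
      have "v \<in> P"
        unfolding H(2)
      proof (clarify)
        fix a \<beta> assume "(a, \<beta>) \<in> H"
        then have "((a, \<beta>), (0, 0)) \<in> S" unfolding S_def by force
        then show "a \<bullet> v \<le> \<beta>" by (rule sat)
      qed
      moreover have "f v = h"
      proof (rule euclidean_eqI)
        fix e :: 'b assume "e \<in> Basis"
        then have "((adjoint f e, e \<bullet> h), (e, 0)) \<in> S" "((- adjoint f e, - (e \<bullet> h)), (- e, 0)) \<in> S"
          unfolding S_def by blast+
        then have "adjoint f e \<bullet> v \<le> e \<bullet> h" "- adjoint f e \<bullet> v \<le> - (e \<bullet> h)"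
          by (auto dest: sat)
        then show "f v \<bullet> e = h \<bullet> e" by (simp add: adj inner_commute[of e h])
      qed
      moreover have "c \<bullet> v \<le> z - \<epsilon>"
        using sat[of c "z - \<epsilon>" "(0, 1)"] by (simp add: S_def)
      ultimately show False using lower \<open>0 < \<epsilon>\<close> by fastforce
    qed
  qed
  then obtain \<mu> l where "((0, -1), (\<mu>, l)) \<in> convex_cone hull S"
    unfolding convex_cone_hull_linear_image[OF linear_fst] by force
  moreover have "0 \<le> l \<and> (\<forall>v\<in>P. g \<bullet> v - \<gamma> \<le> \<mu> \<bullet> (f v - h) + l * (c \<bullet> v - (z - \<epsilon>)))"
    if "((g, \<gamma>), (\<mu>, l)) \<in> S" for g \<gamma> \<mu> l
    using that H(2)
    by (auto simp: S_def inner_diff_right adj linear_0[OF f] inner_commute[of _ h] inner_commute[of "f _"])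
  ultimately have l: "0 \<le> l" and cert: "\<And>v. v \<in> P \<Longrightarrow> 1 \<le> \<mu> \<bullet> (f v - h) + l * (c \<bullet> v - (z - \<epsilon>))"
    using valid_inequality_convex_cone_hull[of S P f h c "z - \<epsilon>" 0 "-1" \<mu> l] by auto
  have "0 < l"
    using cert[OF feasible(1)] feasible(2) l by (cases "l = 0") auto
  show ?thesis
  proof
    fix v assume "v \<in> P"
    have "l * (z - \<epsilon>) \<le> l * (c \<bullet> v) + \<mu> \<bullet> (f v - h)"
      using cert[OF \<open>v \<in> P\<close>] by (simp add: algebra_simps)
    then show "z - \<epsilon> \<le> c \<bullet> v + (1 / l) *\<^sub>R \<mu> \<bullet> (f v - h)"
      using \<open>0 < l\<close> by (simp add: field_simps)
  qed
qed

definition lagrangian_dual ::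
    "(real^'n) set \<Rightarrow> (real^'m) set \<Rightarrow> real^'n^'p \<Rightarrow> real^'m^'p \<Rightarrow> real^'p \<Rightarrow> real^'n \<Rightarrow> real^'m
     \<Rightarrow> real^'p \<Rightarrow> ereal" where
  "lagrangian_dual X Y T Q h c d \<alpha> =
     ereal (- (\<alpha> \<bullet> h)) + sigma X (c + transpose T *v \<alpha>) + sigma Y (transpose Q *v \<alpha> + d)"

lemma sigma_le: "s \<in> S \<Longrightarrow> sigma S \<alpha> \<le> ereal (\<alpha> \<bullet> s)"
  unfolding sigma_def by (rule INF_lower)

lemma ereal_le_sigma_add:
  assumes "x0 \<in> X" "y0 \<in> Y" and bound: "\<And>x y. x \<in> X \<Longrightarrow> y \<in> Y \<Longrightarrow> r \<le> u \<bullet> x + v \<bullet> y"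
  shows "ereal r \<le> sigma X u + sigma Y v"
proof -
  have Y_bound: "ereal (r - u \<bullet> x) \<le> sigma Y v" if "x \<in> X" for x
    unfolding sigma_def by (intro INF_greatest) (auto dest: bound[OF that])
  obtain s where s: "sigma Y v = ereal s"
    using Y_bound[OF assms(1)] sigma_le[OF assms(2), of v] by (cases "sigma Y v") auto
  have X_bound: "r - s \<le> u \<bullet> x" if "x \<in> X" for x
    using Y_bound[OF that] s by simp
  have "ereal (r - s) \<le> sigma X u"
    unfolding sigma_def by (intro INF_greatest) (simp add: X_bound)
  then have "ereal (r - s) + ereal s \<le> sigma X u + ereal s" by (rule add_right_mono)
  then show ?thesis using s by simp
qed

lemma SUP_lagrangian_dual_ge:
  assumes "polyhedron X" "polyhedron Y"
    and feasible: "x0 \<in> X" "y0 \<in> Y" "T *v x0 + Q *v y0 = h"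
    and lower: "\<And>x y. x \<in> X \<Longrightarrow> y \<in> Y \<Longrightarrow> T *v x + Q *v y = h \<Longrightarrow> z \<le> c \<bullet> x + d \<bullet> y"
  shows "ereal z \<le> (SUP \<alpha>. lagrangian_dual X Y T Q h c d \<alpha>)"
proof (rule ereal_le_epsilon2)
  fix \<epsilon> :: real assume "0 < \<epsilon>"
  have lin: "linear (\<lambda>v. T *v fst v + Q *v snd v)"
    using linear_compose[OF linear_fst matrix_vector_mul_linear[of T]]
      linear_compose[OF linear_snd matrix_vector_mul_linear[of Q]]
    by (auto intro: linear_compose_add simp: o_def)
  obtain \<alpha> where \<alpha>: "\<And>v. v \<in> X \<times> Y \<Longrightarrow>
      z - \<epsilon> \<le> (c, d) \<bullet> v + \<alpha> \<bullet> (T *v fst v + Q *v snd v - h)"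
  proof (rule lagrange_multiplier_approx[OF polyhedron_Times[OF assms(1,2)] lin])
    show "(x0, y0) \<in> X \<times> Y" "T *v fst (x0, y0) + Q *v snd (x0, y0) = h"
      using feasible by auto
    show "z \<le> (c, d) \<bullet> v" if "v \<in> X \<times> Y" "T *v fst v + Q *v snd v = h" for v
      using lower that by auto
  qed (use \<open>0 < \<epsilon>\<close> in auto)
  have "ereal (z - \<epsilon> + \<alpha> \<bullet> h) \<le> sigma X (c + transpose T *v \<alpha>) + sigma Y (transpose Q *v \<alpha> + d)"
  proof (rule ereal_le_sigma_add[OF feasible(1,2)])
    fix x y assume "x \<in> X" "y \<in> Y"
    then show "z - \<epsilon> + \<alpha> \<bullet> h \<le> (c + transpose T *v \<alpha>) \<bullet> x + (transpose Q *v \<alpha> + d) \<bullet> y"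
      using \<alpha>[of "(x, y)"] by (simp add: inner_add_left inner_add_right inner_diff_right dot_lmul_matrix)
  qed
  then have "ereal (- (\<alpha> \<bullet> h)) + ereal (z - \<epsilon> + \<alpha> \<bullet> h)
      \<le> ereal (- (\<alpha> \<bullet> h)) + (sigma X (c + transpose T *v \<alpha>) + sigma Y (transpose Q *v \<alpha> + d))"
    by (rule add_left_mono)
  then have "ereal (z - \<epsilon>) \<le> lagrangian_dual X Y T Q h c d \<alpha>"
    unfolding lagrangian_dual_def by (simp add: add.assoc)
  then have "ereal (z - \<epsilon>) \<le> (SUP \<alpha>. lagrangian_dual X Y T Q h c d \<alpha>)"
    by (rule SUP_upper2[OF UNIV_I])
  then show "ereal z \<le> (SUP \<alpha>. lagrangian_dual X Y T Q h c d \<alpha>) + ereal \<epsilon>"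
    by (simp add: ereal_minus_le[symmetric])
qed

lemma lp_value_le_lagrangian_dual:
  assumes "polyhedron X" "polyhedron Y"
    and finite: "\<bar>INF xy\<in>{(x, y). T *v x + Q *v y = h \<and> x \<in> X \<and> y \<in> Y}. ereal (c \<bullet> fst xy + d \<bullet> snd xy)\<bar> \<noteq> \<infinity>"
    and opt: "\<forall>\<alpha>. lagrangian_dual X Y T Q h c d \<alpha> \<le> lagrangian_dual X Y T Q h c d \<alpha>hat"
  shows "(INF xy\<in>{(x, y). T *v x + Q *v y = h \<and> x \<in> X \<and> y \<in> Y}. ereal (c \<bullet> fst xy + d \<bullet> snd xy))
    \<le> lagrangian_dual X Y T Q h c d \<alpha>hat"
  (is "?z \<le> _")
proof -
  obtain z where z: "?z = ereal z" using finite by (cases ?z) auto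
  have lower: "z \<le> c \<bullet> x + d \<bullet> y" if "x \<in> X" "y \<in> Y" "T *v x + Q *v y = h" for x y
  proof -
    have "?z \<le> ereal (c \<bullet> fst (x, y) + d \<bullet> snd (x, y))"
      by (rule INF_lower) (use that in auto)
    then show ?thesis using z by simp
  qed
  have "{(x, y). T *v x + Q *v y = h \<and> x \<in> X \<and> y \<in> Y} \<noteq> {}"
  proof
    assume empty: "{(x, y). T *v x + Q *v y = h \<and> x \<in> X \<and> y \<in> Y} = {}"
    have "?z = \<infinity>" unfolding empty by (simp add: top_ereal_def)
    then show False using finite by simp
  qed
  then obtain x0 y0 where feasible: "x0 \<in> X" "y0 \<in> Y" "T *v x0 + Q *v y0 = h" by auto
  have "ereal z \<le> (SUP \<alpha>. lagrangian_dual X Y T Q h c d \<alpha>)"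
    using SUP_lagrangian_dual_ge[OF assms(1,2) feasible lower] .
  also have "\<dots> \<le> lagrangian_dual X Y T Q h c d \<alpha>hat"
    using opt by (intro SUP_least) simp
  finally show ?thesis using z by simp
qed

section \<open>Bases and corners\<close>

lemma linear_image_eq_subspace:
  fixes f :: "'a::euclidean_space \<Rightarrow> 'b::euclidean_space"
  assumes f: "linear f" and "subspace S" "subspace U" "f ` S \<subseteq> U" "inj_on f S" "dim U \<le> dim S"
  shows "f ` S = U"
proof (rule subspace_dim_equal)
  show "subspace (f ` S)" using f assms(2) by (rule linear_subspace_image)
  have "span S = S" using assms(2) by (simp add: span_eq_iff)
  then have "dim (f ` S) = dim S"
    using assms(5) dim_image_eq[OF f] by metis
  then show "dim U \<le> dim (f ` S)" using assms(6) by simp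
qed (use assms in auto)

definition supported_on :: "'m set \<Rightarrow> (real^'m) set" where
  "supported_on B = {y. \<forall>j. j \<notin> B \<longrightarrow> y $ j = 0}"

lemma mem_supported_on [simp]: "y \<in> supported_on B \<longleftrightarrow> (\<forall>j. j \<notin> B \<longrightarrow> y $ j = 0)"
  by (simp add: supported_on_def)

lemma subspace_supported_on: "subspace (supported_on B)"
  by (auto simp: subspace_def)

lemma dim_supported_on: "dim (supported_on B) = card B"
proof -
  have "vec.dim (supported_on B) = card B"
    unfolding supported_on_def by (rule dim_substandard_cart)
  then show ?thesis by (simp add: dim_vec_eq)
qed

lemma is_basis_inj_on:
  fixes A :: "real^'m^'k"
  assumes "is_basis A B"
  shows "inj_on ((*v) A) (supported_on B)"
proof (rule inj_onI)
  fix x y assume "x \<in> supported_on B" "y \<in> supported_on B" "A *v x = A *v y"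
  then have "(\<forall>j. j \<notin> B \<longrightarrow> (x - y) $ j = 0) \<and> A *v (x - y) = 0"
    by (simp add: matrix_vector_mult_diff_distrib)
  then have "x - y = 0"
    using assms unfolding is_basis_def by blast
  then show "x = y" by simp
qed

lemma is_basis_image_supported_on:
  fixes A :: "real^'m^'k"
  assumes "is_basis A B"
  shows "(*v) A ` supported_on B = UNIV"
proof (rule linear_image_eq_subspace)
  show "inj_on ((*v) A) (supported_on B)" using assms by (rule is_basis_inj_on)
  show "dim (UNIV :: (real^'k) set) \<le> dim (supported_on B)"
    using assms by (simp add: dim_supported_on is_basis_def)
qed (auto simp: subspace_supported_on)

lemma basic_sol:
  fixes A :: "real^'m^'k"
  assumes "is_basis A B"
  shows "basic_sol A b B \<in> supported_on B" and "A *v basic_sol A b B = b"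
proof -
  have "b \<in> (*v) A ` supported_on B"
    using is_basis_image_supported_on[OF assms] by simp
  then obtain y where y: "y \<in> supported_on B" "A *v y = b" by force
  have "\<exists>!y. (\<forall>j. j \<notin> B \<longrightarrow> y $ j = 0) \<and> A *v y = b"
  proof (rule ex1I[of _ y])
    fix y' assume "(\<forall>j. j \<notin> B \<longrightarrow> y' $ j = 0) \<and> A *v y' = b"
    then show "y' = y"
      using y is_basis_inj_on[OF assms] by (auto dest: inj_onD)
  qed (use y in simp)
  from theI'[OF this] show "basic_sol A b B \<in> supported_on B" "A *v basic_sol A b B = b"
    unfolding basic_sol_def by simp_all
qed

lemma is_basis_transpose_eq_0:
  fixes A :: "real^'m^'k"
  assumes "is_basis A B" and "\<forall>j\<in>B. (transpose A *v p) $ j = 0"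
  shows "p = 0"
proof -
  have "p \<in> (*v) A ` supported_on B"
    using is_basis_image_supported_on[OF assms(1)] by simp
  then obtain y where y: "y \<in> supported_on B" "p = A *v y" by force
  have "p \<bullet> p = (transpose A *v p) \<bullet> y"
    using y(2) by (simp add: dot_lmul_matrix)
  also have "\<dots> = 0"
    unfolding inner_vec_def using assms(2) y(1) by (intro sum.neutral) auto
  finally show "p = 0" by simp
qed

lemma is_basis_transpose_solvable:
  fixes A :: "real^'m^'k"
  assumes "is_basis A B"
  obtains p where "\<forall>j\<in>B. (transpose A *v p) $ j = g $ j"
proof -
  define M :: "real^'k^'m" where "M = (\<chi> j. if j \<in> B then transpose A $ j else 0)"
  have M: "(M *v p) $ j = (if j \<in> B then (transpose A *v p) $ j else 0)" for p j
    by (simp add: M_def matrix_vector_mult_def)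
  have "(*v) M ` UNIV = supported_on B"
  proof (rule linear_image_eq_subspace)
    show "inj_on ((*v) M) UNIV"
    proof (rule inj_onI)
      fix p q assume pq: "M *v p = M *v q"
      have "(transpose A *v p) $ j = (transpose A *v q) $ j" if "j \<in> B" for j
        using arg_cong[OF pq, of "\<lambda>v. v $ j"] that by (simp add: M)
      then have "\<forall>j\<in>B. (transpose A *v (p - q)) $ j = 0"
        by (simp add: matrix_vector_mult_diff_distrib)
      then show "p = q" using is_basis_transpose_eq_0[OF assms, of "p - q"] by simp
    qed
    show "dim (supported_on B) \<le> dim (UNIV :: (real^'k) set)"
      using assms by (simp add: dim_supported_on is_basis_def)
  qed (auto simp: M subspace_supported_on)
  moreover have "(\<chi> j. if j \<in> B then g $ j else 0) \<in> supported_on B" by simp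
  ultimately have "(\<chi> j. if j \<in> B then g $ j else 0) \<in> range ((*v) M)" by simp
  then obtain p where p: "(\<chi> j. if j \<in> B then g $ j else 0) = M *v p" by (rule rangeE)
  have "(transpose A *v p) $ j = g $ j" if "j \<in> B" for j
    using arg_cong[OF p, of "\<lambda>v. v $ j"] that by (simp add: M)
  then show ?thesis using that by blast
qed

lemma basis_mult:
  fixes A :: "real^'m^'k"
  assumes "is_basis A B" and "j \<in> B"
  shows "(transpose A *v basis_mult A g B) $ j = g $ j"
proof -
  obtain p where p: "\<forall>j\<in>B. (transpose A *v p) $ j = g $ j"
    using is_basis_transpose_solvable[OF assms(1)] by blast
  have "\<exists>!\<pi>. \<forall>j\<in>B. (transpose A *v \<pi>) $ j = g $ j"
  proof (rule ex1I[of _ p])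
    fix q assume "\<forall>j\<in>B. (transpose A *v q) $ j = g $ j"
    then have "\<forall>j\<in>B. (transpose A *v (q - p)) $ j = 0"
      using p by (simp add: matrix_vector_mult_diff_distrib)
    then show "q = p" using is_basis_transpose_eq_0[OF assms(1), of "q - p"] by simp
  qed (use p in simp)
  from theI'[OF this] show ?thesis
    using assms(2) unfolding basis_mult_def by blast
qed

lemma optimal_basis_basic_sol_feasible:
  assumes "optimal_basis A b g B"
  shows "basic_sol A b B \<in> {y. A *v y = b \<and> (\<forall>j. 0 \<le> y $ j)}"
proof -
  have basis: "is_basis A B" using assms by (simp add: optimal_basis_def)
  have "0 \<le> basic_sol A b B $ j" for j
  proof (cases "j \<in> B")
    case True
    then show ?thesis using assms by (simp add: optimal_basis_def)
  next
    case False
    then show ?thesis using basic_sol(1)[OF basis] by simp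
  qed
  then show ?thesis using basic_sol(2)[OF basis] by simp
qed

lemma optimal_basis_cost_le:
  assumes opt: "optimal_basis A b g B" and y: "y \<in> corner A b B"
  shows "g \<bullet> basic_sol A b B \<le> g \<bullet> y"
proof -
  have basis: "is_basis A B" using opt by (simp add: optimal_basis_def)
  define r where "r = g - transpose A *v basis_mult A g B"
  have cost: "g \<bullet> y' = basis_mult A g B \<bullet> b + r \<bullet> y'" if "A *v y' = b" for y'
    using that by (simp add: r_def inner_diff_left dot_lmul_matrix)
  have r_B: "r $ j = 0" if "j \<in> B" for j
    using basis_mult[OF basis that] by (simp add: r_def)
  have "r \<bullet> basic_sol A b B = 0"
    unfolding inner_vec_def using r_B basic_sol(1)[OF basis] by (intro sum.neutral) auto
  moreover have "0 \<le> r \<bullet> y"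
    unfolding inner_vec_def
  proof (rule sum_nonneg)
    fix j
    show "0 \<le> r $ j \<bullet> y $ j"
      using r_B[of j] opt y unfolding optimal_basis_def corner_def r_def by (cases "j \<in> B") auto
  qed
  ultimately show ?thesis
    using cost[of y] cost[OF basic_sol(2)[OF basis]] y by (simp add: corner_def)
qed

lemma sigma_corner_eq:
  assumes "optimal_basis A b g B"
  shows "sigma (corner A b B) g = sigma {y. A *v y = b \<and> (\<forall>j. 0 \<le> y $ j)} g"
proof (rule antisym)
  show "sigma (corner A b B) g \<le> sigma {y. A *v y = b \<and> (\<forall>j. 0 \<le> y $ j)} g"
    unfolding sigma_def corner_def by (rule INF_superset_mono) auto
  have "sigma {y. A *v y = b \<and> (\<forall>j. 0 \<le> y $ j)} g \<le> ereal (g \<bullet> basic_sol A b B)"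
    using optimal_basis_basic_sol_feasible[OF assms] by (rule sigma_le)
  also have "\<dots> \<le> sigma (corner A b B) g"
    unfolding sigma_def using optimal_basis_cost_le[OF assms] by (auto intro: INF_greatest)
  finally show "sigma {y. A *v y = b \<and> (\<forall>j. 0 \<le> y $ j)} g \<le> sigma (corner A b B) g" .
qed

section \<open>Value functions\<close>

lemma le_add_fval_iff:
  "e \<le> ereal r + fval d Q C w \<longleftrightarrow> (\<forall>y\<in>C. Q *v y = w \<longrightarrow> e \<le> ereal (r + d \<bullet> y))"
proof -
  have "e \<le> ereal r + fval d Q C w \<longleftrightarrow> e - ereal r \<le> fval d Q C w"
    by (simp add: ereal_minus_le add.commute)
  also have "\<dots> \<longleftrightarrow> (\<forall>y\<in>C. Q *v y = w \<longrightarrow> e - ereal r \<le> ereal (d \<bullet> y))"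
    unfolding fval_def by (auto simp: le_INF_iff)
  also have "\<dots> \<longleftrightarrow> (\<forall>y\<in>C. Q *v y = w \<longrightarrow> e \<le> ereal (r + d \<bullet> y))"
    by (simp add: ereal_minus_le add.commute)
  finally show ?thesis .
qed

lemma INF_epi_fval:
  "(INF x\<theta>\<in>{(x, \<theta>). x \<in> X \<and> (h - T *v x, \<theta>) \<in> epi (fval d Q C)}. ereal (c \<bullet> fst x\<theta> + snd x\<theta>))
   = (INF xy\<in>{(x, y). T *v x + Q *v y = h \<and> x \<in> X \<and> y \<in> C}. ereal (c \<bullet> fst xy + d \<bullet> snd xy))"
  (is "?epi = ?lp")
proof (rule antisym)
  show "?epi \<le> ?lp"
  proof (rule INF_greatest)
    fix p assume "p \<in> {(x, y). T *v x + Q *v y = h \<and> x \<in> X \<and> y \<in> C}"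
    then obtain x y where p: "p = (x, y)" and xy: "T *v x + Q *v y = h" "x \<in> X" "y \<in> C"
      by blast
    then have "fval d Q C (h - T *v x) \<le> ereal (d \<bullet> y)"
      unfolding fval_def by (intro INF_lower) (auto simp: algebra_simps)
    with xy have "(x, d \<bullet> y) \<in> {(x, \<theta>). x \<in> X \<and> (h - T *v x, \<theta>) \<in> epi (fval d Q C)}"
      by (simp add: epi_def)
    then show "?epi \<le> ereal (c \<bullet> fst p + d \<bullet> snd p)"
      by (rule INF_lower2) (simp add: p)
  qed
  show "?lp \<le> ?epi"
  proof (rule INF_greatest)
    fix p assume "p \<in> {(x, \<theta>). x \<in> X \<and> (h - T *v x, \<theta>) \<in> epi (fval d Q C)}"
    then obtain x \<theta> where p: "p = (x, \<theta>)" and "x \<in> X" and epi: "(h - T *v x, \<theta>) \<in> epi (fval d Q C)"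
      by blast
    have "?lp \<le> ereal (c \<bullet> x) + fval d Q C (h - T *v x)"
      unfolding le_add_fval_iff using \<open>x \<in> X\<close> by (auto intro!: INF_lower2 simp: algebra_simps)
    also have "\<dots> \<le> ereal (c \<bullet> x) + ereal \<theta>"
      using epi by (intro add_left_mono) (simp add: epi_def)
    finally show "?lp \<le> ereal (c \<bullet> fst p + snd p)" by (simp add: p)
  qed
qed

lemma sigma_epi_fval_le:
  "sigma (epi (fval d Q Y)) (\<alpha>, 1) \<le> sigma Y (transpose Q *v \<alpha> + d)"
  unfolding sigma_def[of Y]
proof (rule INF_greatest)
  fix y assume "y \<in> Y"
  then have "(Q *v y, d \<bullet> y) \<in> epi (fval d Q Y)"
    unfolding epi_def fval_def by (auto intro: INF_lower)
  then have "sigma (epi (fval d Q Y)) (\<alpha>, 1) \<le> ereal ((\<alpha>, 1) \<bullet> (Q *v y, d \<bullet> y))"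
    by (rule sigma_le)
  then show "sigma (epi (fval d Q Y)) (\<alpha>, 1) \<le> ereal ((transpose Q *v \<alpha> + d) \<bullet> y)"
    by (simp add: inner_add_left dot_lmul_matrix)
qed

lemma sigma_le_of_epi_fval:
  assumes "(w, \<theta>) \<in> epi (fval d Q C)"
  shows "sigma C (transpose Q *v \<alpha> + d) \<le> ereal (\<alpha> \<bullet> w + \<theta>)"
proof -
  have "sigma C (transpose Q *v \<alpha> + d) \<le> ereal (\<alpha> \<bullet> w) + fval d Q C w"
    unfolding le_add_fval_iff
    by (auto dest: sigma_le[of _ C "transpose Q *v \<alpha> + d"] simp: inner_add_left dot_lmul_matrix)
  also have "\<dots> \<le> ereal (\<alpha> \<bullet> w) + ereal \<theta>"
    using assms by (intro add_left_mono) (simp add: epi_def)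
  finally show ?thesis by simp
qed

lemma lagrangian_dual_le_corner:
  assumes "optimal_basis A b (transpose Q *v \<alpha> + d) B"
    and "x \<in> X" "y \<in> corner A b B" "T *v x + Q *v y = h"
  shows "lagrangian_dual X {y. A *v y = b \<and> (\<forall>j. 0 \<le> y $ j)} T Q h c d \<alpha> \<le> ereal (c \<bullet> x + d \<bullet> y)"
proof -
  have "lagrangian_dual X {y. A *v y = b \<and> (\<forall>j. 0 \<le> y $ j)} T Q h c d \<alpha>
      \<le> ereal (- (\<alpha> \<bullet> h)) + ereal ((c + transpose T *v \<alpha>) \<bullet> x) + ereal ((transpose Q *v \<alpha> + d) \<bullet> y)"
    unfolding lagrangian_dual_def sigma_corner_eq[OF assms(1), symmetric]
    using assms(2,3) by (intro add_mono order_refl sigma_le)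
  also have "\<dots> = ereal (c \<bullet> x + d \<bullet> y)"
  proof -
    have "\<alpha> \<bullet> (T *v x) + \<alpha> \<bullet> (Q *v y) = \<alpha> \<bullet> h"
      using assms(4) by (metis inner_add_right)
    then show ?thesis by (simp add: inner_add_left dot_lmul_matrix)
  qed
  finally show ?thesis .
qed

theorem mainTheorem6:
  fixes X :: "(real^'n) set" and T :: "real^'n^'p" and Q :: "real^'m^'p"
    and h :: "real^'p" and c :: "real^'n" and d :: "real^'m"
    and A :: "real^'m^'k" and b :: "real^'k"
    and Y :: "(real^'m) set" and zstar :: ereal
    and \<alpha>hat :: "real^'p" and B :: "'m set"
  assumes X_poly: "polyhedron X" and X_ne: "X \<noteq> {}"
    and Y_def: "Y = {y. A *v y = b \<and> (\<forall>j. y $ j \<ge> 0)}"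
    and A_rank: "rank A = CARD('k)"
    and zstar_def: "zstar = (INF xy\<in>{(x, y). T *v x + Q *v y = h \<and> x \<in> X \<and> y \<in> Y}.
                                ereal (c \<bullet> fst xy + d \<bullet> snd xy))"
    and zstar_finite: "\<bar>zstar\<bar> \<noteq> \<infinity>"
    and \<alpha>hat_opt: "\<forall>\<alpha>::real^'p.
          ereal (- (\<alpha> \<bullet> h)) + sigma X (c + transpose T *v \<alpha>) + sigma Y (transpose Q *v \<alpha> + d)
          \<le> ereal (- (\<alpha>hat \<bullet> h)) + sigma X (c + transpose T *v \<alpha>hat) + sigma Y (transpose Q *v \<alpha>hat + d)"
    and B_opt: "optimal_basis A b (transpose Q *v \<alpha>hat + d) B"
  shows "(INF x\<theta>\<in>{(x, \<theta>). x \<in> X \<and> (h - T *v x, \<theta>) \<in> epi (fval d Q (corner A b B))}.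
            ereal (c \<bullet> fst x\<theta> + snd x\<theta>)) = zstar
       \<and> (\<forall>x \<theta>. (h - T *v x, \<theta>) \<in> epi (fval d Q (corner A b B)) \<longrightarrow>
            ereal (\<alpha>hat \<bullet> (h - T *v x) + \<theta>) \<ge> sigma (epi (fval d Q Y)) (\<alpha>hat, 1))"
proof -
  let ?C = "corner A b B"
  have "polyhedron Y" using Y_def polyhedron_standard_form by simp
  have "zstar \<le> lagrangian_dual X Y T Q h c d \<alpha>hat"
    unfolding zstar_def using \<alpha>hat_opt
    by (intro lp_value_le_lagrangian_dual[OF X_poly \<open>polyhedron Y\<close> zstar_finite[unfolded zstar_def]])
      (simp add: lagrangian_dual_def)
  then have corner_lower: "zstar \<le> ereal (c \<bullet> x + d \<bullet> y)"
    if "x \<in> X" "y \<in> ?C" "T *v x + Q *v y = h" for x y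
    using order_trans lagrangian_dual_le_corner[OF B_opt that] Y_def by blast
  have "(INF xy\<in>{(x, y). T *v x + Q *v y = h \<and> x \<in> X \<and> y \<in> ?C}. ereal (c \<bullet> fst xy + d \<bullet> snd xy))
      = zstar"
  proof (rule antisym)
    show "(INF xy\<in>{(x, y). T *v x + Q *v y = h \<and> x \<in> X \<and> y \<in> ?C}. ereal (c \<bullet> fst xy + d \<bullet> snd xy))
        \<le> zstar"
      unfolding zstar_def Y_def by (intro INF_superset_mono) (auto simp: corner_def)
    show "zstar \<le> (INF xy\<in>{(x, y). T *v x + Q *v y = h \<and> x \<in> X \<and> y \<in> ?C}. ereal (c \<bullet> fst xy + d \<bullet> snd xy))"
      using corner_lower by (auto intro!: INF_greatest)
  qed
  moreover have "sigma (epi (fval d Q Y)) (\<alpha>hat, 1) \<le> ereal (\<alpha>hat \<bullet> (h - T *v x) + \<theta>)"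
    if "(h - T *v x, \<theta>) \<in> epi (fval d Q ?C)" for x \<theta>
  proof -
    have "sigma (epi (fval d Q Y)) (\<alpha>hat, 1) \<le> sigma Y (transpose Q *v \<alpha>hat + d)"
      by (rule sigma_epi_fval_le)
    also have "\<dots> = sigma ?C (transpose Q *v \<alpha>hat + d)"
      using sigma_corner_eq[OF B_opt] Y_def by simp
    also have "\<dots> \<le> ereal (\<alpha>hat \<bullet> (h - T *v x) + \<theta>)"
      using that by (rule sigma_le_of_epi_fval)
    finally show ?thesis .
  qed
  ultimately show ?thesis by (simp add: INF_epi_fval)
qed

end
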